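(* Let $K$ be a field complete for a rank-one valuation $\operatorname{ord}$ of mixed characteristic $(0,p)$ with $\operatorname{ord}(p)=1$. Fix data $N\ge1$, a real number $0\le H<(p-1)/p^N$, and reals $U_1,\dots,U_g\ge0$ with $\sum_iU_i=H$. For $i=1,\dots,g$ let \[ f_i(X_1,\dots,X_g)=\sum_{j=1}^g\sum_{n=0}^\infty a_{n,ij}X_j^{p^n}\in K[[X_1,\dots,X_g]], \] and put $u_{n,ij}=\operatorname{ord}(a_{n,ij})\in\mathbb R\cup\{\infty\}$. Let $N_i$ be the largest integer with $\frac{p^{N_i}-1}{p-1}U_i<1$ ($N_i=\infty$ if $U_i=0$), and assume: (i) $u_{0,ii}=0$ for all $i$ and $u_{0,ij}=\infty$ for $i\ne j$; (ii) $u_{n,ii}=\frac{p^n-1}{p-1}U_i-n$ for $1\le n\le N_i$; (iii) $u_{n,ii}\ge 1-n$ for $n>N_i$; (iv) $u_{n,ij}\ge -n$ for all $i,j$ and $n\ge0$, and $u_{n,ij}\ge 1-n$ when $i>j$. Let $r=\frac1{p^N(p-1)}$ and $r'=\frac1{p^{N-1}(p-1)}-\frac H{p-1}$. Then \[ \bigcap_{i=1}^g\operatorname{Trop}(f_i)\cap\mathbb R^g_{>r}=\bigcap_{i=1}^g\operatorname{Trop}(f_i)\cap\mathbb R^g_{\ge r'}\quad\text{and}\quad \bigcap_{i=1}^g\operatorname{Trop}(f_i)\cap\mathbb R^g_{>1/(p-1)}=\emptyset. \]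
   Context: For a nonzero power series $f=\sum_\nu a_\nu X^\nu$ in $g$ variables converging on the open unit polydisc, its tropicalization $\operatorname{Trop}(f)$ is the set of $w\in\mathbb R^g_{>0}$ such that the minimum of $\operatorname{ord}(a_\nu)+\langle w,\nu\rangle$ over the monomials with $a_\nu\ne0$ is attained by at least two distinct exponents $\nu$. $\mathbb R^g_{>r}$ (resp. $\mathbb R^g_{\ge r'}$) denotes the set of vectors all of whose coordinates are $>r$ (resp. $\ge r'$). *)

theory Defs
  imports "HOL-Analysis.Analysis" "HOL-Computational_Algebra.Primes"
begin

text \<open>
  A valuation of rank one is written additively, with values in the reals together with
  infinity; rank one means that the value group is a nonzero subgroup of the reals.
  The characteristic of the residue field is described as usual by the natural
  numbers that vanish in it, i.e. that have positive valuation.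
\<close>

locale rank_one_valuation =
  fixes ord :: "'a::field \<Rightarrow> ereal"
  assumes ord_not_MInf: "ord x \<noteq> -\<infinity>"
    and ord_eq_PInf_iff: "ord x = \<infinity> \<longleftrightarrow> x = 0"
    and ord_mult: "ord (x * y) = ord x + ord y"
    and ord_add: "min (ord x) (ord y) \<le> ord (x + y)"
    and ord_nontrivial: "\<exists>x. x \<noteq> 0 \<and> ord x \<noteq> 0"

locale complete_rank_one_valuation = rank_one_valuation +
  assumes ord_complete:
    "(\<forall>M::real. \<exists>n0. \<forall>m\<ge>n0. \<forall>n\<ge>n0. ereal M < ord (s m - s n)) \<Longrightarrow>
      \<exists>l. ((\<lambda>n. ord (s n - l)) \<longlonglongrightarrow> \<infinity>)"

locale complete_mixed_char_valuation =
  complete_rank_one_valuation ord for ord :: "'a::field_char_0 \<Rightarrow> ereal" +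
  fixes p :: nat
  assumes prime_p: "prime p"
    and residue_char: "0 < ord (of_nat n) \<longleftrightarrow> p dvd n"
    and ord_p: "ord (of_nat p) = 1"

text \<open>
  A formal power series in the variables \<open>X\<^sub>i\<close>, with \<open>i\<close> ranging over the index type
  \<open>'g\<close>, is the family of its coefficients, indexed by exponents \<open>\<nu> :: 'g \<Rightarrow> nat\<close>.
\<close>

type_synonym ('a, 'g) mv_series = "('g \<Rightarrow> nat) \<Rightarrow> 'a"

definition Trop :: "('a::zero \<Rightarrow> ereal) \<Rightarrow> ('a, 'g::finite) mv_series \<Rightarrow> (real ^ 'g) set" where
  "Trop ord f = {w. (\<forall>i. 0 < w $ i) \<and>
     (\<exists>\<mu> \<nu>. \<mu> \<noteq> \<nu> \<and>
       (\<forall>\<kappa>\<in>{\<mu>, \<nu>}. is_arg_min (\<lambda>\<nu>. ord (f \<nu>) + ereal (\<Sum>i\<in>UNIV. w $ i * real (\<nu> i)))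
                              (\<lambda>\<nu>. f \<nu> \<noteq> 0) \<kappa>))}"

definition var_power :: "'g \<Rightarrow> nat \<Rightarrow> 'g \<Rightarrow> nat" where
  "var_power j m = (\<lambda>k. if k = j then m else 0)"

text \<open>
  The formal sum over \<open>j\<close> and \<open>n\<close> of \<open>c n j * X\<^sub>j ^ (p ^ n)\<close>.  For \<open>p \<ge> 2\<close> the inner sum
  below has at most one term.
\<close>

definition p_power_series :: "nat \<Rightarrow> (nat \<Rightarrow> 'g \<Rightarrow> 'a) \<Rightarrow> ('a::comm_monoid_add, 'g::finite) mv_series" where
  "p_power_series p c = (\<lambda>\<nu>. \<Sum>j\<in>UNIV. \<Sum>n | \<nu> = var_power j (p ^ n). c n j)"

lemma p_power_series_var_power:
  assumes "p \<ge> 2"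
  shows "p_power_series p c (var_power j (p ^ n)) = c n j"
proof -
  have "var_power j (p ^ n) = var_power k (p ^ m) \<longleftrightarrow> k = j \<and> m = n" for k m
    using assms by (auto simp: var_power_def fun_eq_iff split: if_splits)
  then have "{m. var_power j (p ^ n) = var_power k (p ^ m)} = (if k = j then {n} else {})" for k
    by auto
  then have "p_power_series p c (var_power j (p ^ n)) = (\<Sum>k\<in>UNIV. if k = j then c n k else 0)"
    unfolding p_power_series_def by (intro sum.cong) auto
  then show ?thesis by simp
qed

lemma p_power_series_eq_0:
  assumes "\<And>j n. \<nu> \<noteq> var_power j (p ^ n)"
  shows "p_power_series p c \<nu> = 0"
  using assms by (simp add: p_power_series_def)

definition max_level :: "nat \<Rightarrow> real \<Rightarrow> enat" where
  "max_level p U = (if U = 0 then \<infinity>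
     else enat (GREATEST n. (real p ^ n - 1) / (real p - 1) * U < 1))"

end

theory Submission
  imports Defs
begin

text \<open>
  Let \<open>w\<close> lie in all the tropicalizations and write \<open>R = 1 / (p^(N-1) (p-1))\<close>.
  For \<open>r < x < R\<close> the number \<open>p^n x - n\<close> is minimal exactly at \<open>n = N\<close>.  Suppose that the
  minimum \<open>m\<close> of the coordinates of \<open>w\<close> satisfies \<open>r < m < r'\<close>, and consider the indices \<open>i\<close> with
  \<open>p^N w_i \<le> p^N m + (p^N - 1) / (p - 1) * (\<Sum>j<i. U_j)\<close>; an index where \<open>m\<close> is attained is one
  of them.  For such an \<open>i\<close> the monomial \<open>X_i^(p^N)\<close> strictly beats all other powers of \<open>X_i\<close> in
  \<open>f_i\<close>, so some power of \<open>X_j\<close> with \<open>j \<noteq> i\<close> does at least as well.  The extra \<open>1\<close> in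
  the bound for \<open>i > j\<close> excludes \<open>j < i\<close> because \<open>(p^N - 1) / (p - 1) * H < 1\<close>, and if \<open>j > i\<close>
  then \<open>j\<close> is again such an index.  This contradicts the finiteness of the index set.
\<close>

text \<open>Bernoulli gives q^k - 1 \<ge> k (q - 1), so raising the exponent from N to N + k
  increases the power term by at least k q^N (q - 1) x, which exceeds the k that is
  subtracted.\<close>

lemma power_times_minus_less_above:
  fixes q x :: real
  assumes "1 < q" "1 / (q ^ N * (q - 1)) < x" "N < n"
  shows "q ^ N * x - real N < q ^ n * x - real n"
proof -
  define k where "k = n - N"
  have n: "n = N + k" and k: "0 < k"
    using assms by (auto simp: k_def)
  have x: "0 < x"
    using assms by (smt (verit) divide_nonneg_nonneg mult_nonneg_nonneg zero_le_power)
  have "1 + real k * (q - 1) \<le> q ^ k"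
    using Bernoulli_inequality[of "q - 1" k] assms by simp
  then have "real k * (q - 1) * (q ^ N * x) \<le> (q ^ k - 1) * (q ^ N * x)"
    using assms x by (intro mult_right_mono) auto
  moreover have "1 < q ^ N * (q - 1) * x"
    using assms by (simp add: field_simps)
  then have "real k * 1 < real k * (q ^ N * (q - 1) * x)"
    using k by (intro mult_strict_left_mono) auto
  ultimately show ?thesis
    unfolding n by (simp add: algebra_simps power_add)
qed

text \<open>Bernoulli for 1/q bounds q^N x - q^n x by N - n times the last increment q^(N-1) (q - 1)
  x. The non-strict form serves points capped at the bound itself.\<close>

lemma power_times_minus_below:
  fixes q x :: real
  assumes "1 < q" "0 \<le> x" "n < N"
  shows "x \<le> 1 / (q ^ (N - 1) * (q - 1)) \<Longrightarrow> q ^ N * x - real N \<le> q ^ n * x - real n"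
    and "x < 1 / (q ^ (N - 1) * (q - 1)) \<Longrightarrow> q ^ N * x - real N < q ^ n * x - real n"
proof -
  define k where "k = N - n"
  have N: "N = n + k" and k: "0 < k"
    using assms by (auto simp: k_def)
  have "1 + real k * (1 / q - 1) \<le> (1 / q) ^ k"
    using Bernoulli_inequality[of "1 / q - 1" k] assms by simp
  then have "(1 - (1 / q) ^ k) * (q ^ N * x) \<le> (real k * (1 - 1 / q)) * (q ^ N * x)"
    using assms by (intro mult_right_mono) (auto simp: algebra_simps)
  also have "(1 - 1 / q) * q ^ N = q ^ (N - 1) * (q - 1)"
    using assms by (cases N) (auto simp: field_simps)
  then have "(real k * (1 - 1 / q)) * (q ^ N * x) = real k * (q ^ (N - 1) * (q - 1) * x)"
    by (metis mult.assoc)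
  also have "(1 - (1 / q) ^ k) * (q ^ N * x) = q ^ N * x - q ^ n * x"
    using assms(1) unfolding N by (simp add: field_simps power_add)
  finally have *: "q ^ N * x - q ^ n * x \<le> real k * (q ^ (N - 1) * (q - 1) * x)" .
  {
    assume "x \<le> 1 / (q ^ (N - 1) * (q - 1))"
    then have "q ^ (N - 1) * (q - 1) * x \<le> 1"
      using assms(1) by (simp add: field_simps)
    then have "real k * (q ^ (N - 1) * (q - 1) * x) \<le> real k * 1"
      by (intro mult_left_mono) auto
    with * show "q ^ N * x - real N \<le> q ^ n * x - real n"
      unfolding N by simp
  next
    assume "x < 1 / (q ^ (N - 1) * (q - 1))"
    then have "q ^ (N - 1) * (q - 1) * x < 1"
      using assms(1) by (simp add: field_simps)
    then have "real k * (q ^ (N - 1) * (q - 1) * x) < real k * 1"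
      using k by (intro mult_strict_left_mono) auto
    with * show "q ^ N * x - real N < q ^ n * x - real n"
      unfolding N by simp
  }
qed

lemma power_times_minus_unique_min:
  fixes q x :: real
  assumes "1 < q" "1 / (q ^ N * (q - 1)) < x" "x < 1 / (q ^ (N - 1) * (q - 1))" "n \<noteq> N"
  shows "q ^ N * x - real N < q ^ n * x - real n"
proof -
  have "0 \<le> x"
    using assms by (smt (verit) divide_nonneg_nonneg mult_nonneg_nonneg zero_le_power)
  then show ?thesis
    using assms power_times_minus_less_above[of q N x n] power_times_minus_below(2)[of q x n N]
    by (cases "n < N") auto
qed

text \<open>Monotonicity in y allows a coordinate beyond the interval where N is optimal to be
  replaced by a smaller x inside it.\<close>

lemma power_times_minus_min:
  fixes q x y :: real
  assumes "1 < q" "1 / (q ^ N * (q - 1)) < x" "x \<le> 1 / (q ^ (N - 1) * (q - 1))" "x \<le> y"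
  shows "q ^ N * x - real N \<le> q ^ n * y - real n"
proof -
  have "0 \<le> x"
    using assms by (smt (verit) divide_nonneg_nonneg mult_nonneg_nonneg zero_le_power)
  then have "q ^ N * x - real N \<le> q ^ n * x - real n"
    using assms power_times_minus_less_above[of q N x n] power_times_minus_below(1)[of q x n N]
    by (cases n N rule: linorder_cases) auto
  also have "\<dots> \<le> q ^ n * y - real n"
    using assms by simp
  finally show ?thesis .
qed

text \<open>\<open>GREATEST\<close> is only meaningful for a bounded set. By Bernoulli the quotient
  is at least n, so for U > 0 every admissible n is below 1/U.\<close>

lemma le_max_level:
  assumes "2 \<le> p" "0 \<le> U" "(real p ^ n - 1) / (real p - 1) * U < 1"
  shows "enat n \<le> max_level p U"
proof (cases "U = 0")
  case True
  then show ?thesis by (simp add: max_level_def)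
next
  case False
  have "m \<le> nat \<lceil>1 / U\<rceil>" if m: "(real p ^ m - 1) / (real p - 1) * U < 1" for m
  proof -
    have "1 + real m * (real p - 1) \<le> real p ^ m"
      using Bernoulli_inequality[of "real p - 1" m] assms by simp
    then have "real m \<le> (real p ^ m - 1) / (real p - 1)"
      using assms by (simp add: field_simps)
    then have "real m * U < 1"
      using m assms by (smt (verit) mult_right_mono)
    then have "real m < 1 / U"
      using False assms by (simp add: field_simps)
    then show ?thesis by linarith
  qed
  then have "n \<le> (GREATEST n. (real p ^ n - 1) / (real p - 1) * U < 1)"
    using assms(3) by (intro Greatest_le_nat) auto
  then show ?thesis
    using False by (simp add: max_level_def)
qed

text \<open>Of two distinct minimal exponents at least one is not that of X_l^(p^k), and its nonzero
  coefficient forces it to belong to some X_j^(p^n).\<close>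

lemma Trop_p_power_series_competitor:
  fixes c :: "nat \<Rightarrow> 'g::finite \<Rightarrow> 'a::comm_monoid_add"
  assumes "2 \<le> p" "w \<in> Trop ord (p_power_series p c)" "c k l \<noteq> 0"
  obtains n j where "(n, j) \<noteq> (k, l)"
    and "c n j \<noteq> 0"
    and "ord (c n j) + ereal (real p ^ n * w $ j) \<le> ord (c k l) + ereal (real p ^ k * w $ l)"
proof -
  let ?f = "p_power_series p c"
  let ?v = "\<lambda>\<nu>. ord (?f \<nu>) + ereal (\<Sum>i\<in>UNIV. w $ i * real (\<nu> i))"
  have v: "?v (var_power j (p ^ n)) = ord (c n j) + ereal (real p ^ n * w $ j)" for j n
  proof -
    have "(\<Sum>i\<in>UNIV. w $ i * real (var_power j (p ^ n) i))
        = (\<Sum>i\<in>UNIV. if i = j then real p ^ n * w $ j else 0)"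
      by (intro sum.cong) (auto simp: var_power_def)
    then show ?thesis
      using assms(1) by (simp add: p_power_series_var_power)
  qed
  define minimal where "minimal = is_arg_min ?v (\<lambda>\<nu>. ?f \<nu> \<noteq> 0)"
  from assms(2) obtain \<mu> \<nu> where "\<mu> \<noteq> \<nu>" "minimal \<mu>" "minimal \<nu>"
    unfolding Trop_def minimal_def by blast
  then obtain \<kappa> where \<kappa>: "\<kappa> \<noteq> var_power l (p ^ k)" "minimal \<kappa>"
    by metis
  then have "?f \<kappa> \<noteq> 0"
    by (simp add: minimal_def is_arg_min_def)
  then obtain j n where jn: "\<kappa> = var_power j (p ^ n)"
    using p_power_series_eq_0 by metis
  have "?f (var_power l (p ^ k)) \<noteq> 0"
    using assms by (simp add: p_power_series_var_power)
  then have "?v \<kappa> \<le> ?v (var_power l (p ^ k))"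
    using \<kappa>(2) unfolding minimal_def is_arg_min_def by (meson not_less)
  then have "ord (c n j) + ereal (real p ^ n * w $ j) \<le> ord (c k l) + ereal (real p ^ k * w $ l)"
    unfolding jn v .
  moreover have "(n, j) \<noteq> (k, l)"
    using \<kappa>(1) jn by auto
  moreover have "c n j \<noteq> 0"
    using \<open>?f \<kappa> \<noteq> 0\<close> assms(1) by (simp add: jn p_power_series_var_power)
  ultimately show ?thesis
    using that by blast
qed

theorem theorem9p10:
  fixes ord :: "'a::field_char_0 \<Rightarrow> ereal"
    and p N :: nat
    and H r r' :: real
    and U :: "'g::{finite,linorder} \<Rightarrow> real"
    and a :: "nat \<Rightarrow> 'g \<Rightarrow> 'g \<Rightarrow> 'a"
    and f :: "'g \<Rightarrow> ('a, 'g) mv_series"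
  assumes "complete_mixed_char_valuation ord p"
    and "1 \<le> N"
    and "0 \<le> H" and "H < (real p - 1) / real p ^ N"
    and "\<forall>i. 0 \<le> U i" and "(\<Sum>i\<in>UNIV. U i) = H"
    and "\<forall>i. f i = p_power_series p (\<lambda>n j. a n i j)"
    and "\<forall>i. ord (a 0 i i) = 0"
    and "\<forall>i j. i \<noteq> j \<longrightarrow> ord (a 0 i j) = \<infinity>"
    and "\<forall>i n. 1 \<le> n \<and> enat n \<le> max_level p (U i) \<longrightarrow>
           ord (a n i i) = ereal ((real p ^ n - 1) / (real p - 1) * U i - real n)"
    and "\<forall>i n. max_level p (U i) < enat n \<longrightarrow> ereal (1 - real n) \<le> ord (a n i i)"
    and "\<forall>i j n. ereal (- real n) \<le> ord (a n i j)"
    and "\<forall>i j n. i > j \<longrightarrow> ereal (1 - real n) \<le> ord (a n i j)"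
    and "r = 1 / (real p ^ N * (real p - 1))"
    and "r' = 1 / (real p ^ (N - 1) * (real p - 1)) - H / (real p - 1)"
  shows "(\<Inter>i. Trop ord (f i)) \<inter> {w. \<forall>i. w $ i > r} = (\<Inter>i. Trop ord (f i)) \<inter> {w. \<forall>i. w $ i \<ge> r'} \<and>
         (\<Inter>i. Trop ord (f i)) \<inter> {w. \<forall>i. w $ i > 1 / (real p - 1)} = {}"
proof -
  interpret complete_mixed_char_valuation ord p by fact

  \<comment> \<open>Constants and the inequality r < r'\<close>
  define q where "q = real p"
  define h where "h = (q ^ N - 1) / (q - 1)"
  define R where "R = 1 / (q ^ (N - 1) * (q - 1))"
  note r_def = assms(14)[folded q_def]
  note ord_diag = assms(10)[rule_format, folded q_def]
  note ord_ge = assms(12)[rule_format]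
  have p: "2 \<le> p"
    using prime_p by (rule prime_ge_2_nat)
  then have q: "2 \<le> q" by (simp add: q_def)
  have qN: "1 \<le> q ^ N"
    using q by (intro one_le_power) auto
  have qN': "q ^ N = q * q ^ (N - 1)"
    using \<open>1 \<le> N\<close> by (cases N) auto
  have U: "0 \<le> U i" for i
    using assms(5) by blast
  have H: "0 \<le> H" "H < (q - 1) / q ^ N" "(\<Sum>i\<in>UNIV. U i) = H"
    using assms(3,4,6) by (auto simp: q_def)
  have r': "r' = R - H / (q - 1)"
    using assms(15) by (simp add: R_def q_def)
  have h: "0 \<le> h" "h \<le> q ^ N / (q - 1)"
    using q qN by (auto simp: h_def divide_right_mono)
  have hH: "h * H < 1"
  proof -
    have "h * H \<le> q ^ N / (q - 1) * H"
      using h H by (intro mult_right_mono) auto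
    also have "\<dots> < 1"
      using H(2) q qN by (simp add: field_simps)
    finally show ?thesis .
  qed
  \<comment> \<open>Here R = q r and H / (q - 1) < (q - 1) r, so r' = R - H / (q - 1) exceeds
    r.\<close>
  have r_less_r': "r < r'"
  proof -
    have "R = q * r"
      using q by (simp add: R_def r_def qN')
    moreover have "H / (q - 1) < 1 / q ^ N"
      using H(2) q qN by (simp add: field_simps)
    moreover have "1 / q ^ N = (q - 1) * r"
      using q by (simp add: r_def)
    ultimately show ?thesis
      unfolding r' by (simp add: algebra_simps)
  qed

  \<comment> \<open>Competing monomials with real valuations, and a minimal coordinate\<close>
  have competitor: thesis
    if "w \<in> (\<Inter>i. Trop ord (f i))" "ord (a k i i) = ereal u"
      "\<And>n j v. (n, j) \<noteq> (k, i) \<Longrightarrow> ord (a n i j) = ereal v \<Longrightarrow> v + q ^ n * w $ j \<le> u + q ^ k * w $ i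
        \<Longrightarrow> thesis" for w k i u thesis
  proof -
    have "w \<in> Trop ord (p_power_series p (\<lambda>n j. a n i j))"
      using that(1) assms(7) by auto
    moreover have "a k i i \<noteq> 0"
      using that(2) ord_eq_PInf_iff[of "a k i i"] by auto
    ultimately obtain n j where nj: "(n, j) \<noteq> (k, i)" "a n i j \<noteq> 0"
      "ord (a n i j) + ereal (q ^ n * w $ j) \<le> ord (a k i i) + ereal (q ^ k * w $ i)"
      using Trop_p_power_series_competitor[OF p, of w ord "\<lambda>n j. a n i j" k i]
      unfolding q_def by metis
    obtain v where "ord (a n i j) = ereal v"
      using nj(2) ord_eq_PInf_iff ord_not_MInf by (cases "ord (a n i j)") auto
    with nj that(2) show thesis
      by (intro that(3)[of n j v]) auto
  qed
  have min_coord: "\<exists>i. \<forall>j. w $ i \<le> w $ j" for w :: "(real, 'g) vec"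
  proof -
    have "Min (range (($) w)) \<in> range (($) w)"
      by (intro Min_in) auto
    then obtain i where "w $ i = Min (range (($) w))" by (metis imageE)
    then show ?thesis by (intro exI[of _ i]) simp
  qed

  \<comment> \<open>No common point has its minimal coordinate strictly between r and r'\<close>
  have ge: "r' \<le> w $ i0" if w: "w \<in> (\<Inter>i. Trop ord (f i))" "\<And>i. r < w $ i"
    and i0: "\<And>j. w $ i0 \<le> w $ j" for w i0
  proof (rule ccontr)
    define m where "m = w $ i0"
    assume "\<not> r' \<le> w $ i0"
    then have "m < r'" by (simp add: m_def)
    then have mR: "m + H / (q - 1) < R" by (simp add: r')
    then have m_less: "m < R"
      using H q by (smt (verit) divide_nonneg_nonneg)
    \<comment> \<open>Passing from an index i to a larger one costs at most h \<open>U i\<close>.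
      The slack sums these costs over all smaller indices, so it never exceeds h H < 1.\<close>
    define S where "S = {i. q ^ N * w $ i \<le> q ^ N * m + h * (\<Sum>j\<in>{..<i}. U j)}"
    have step: "\<exists>j\<in>S. i < j" if "i \<in> S" for i
    proof -
      have sum_split: "(\<Sum>j\<in>{..i}. U j) = U i + (\<Sum>j\<in>{..<i}. U j)"
      proof -
        have "{..i} = insert i {..<i}" by auto
        then show ?thesis by simp
      qed
      have sum_le: "(\<Sum>j\<in>{..i}. U j) \<le> H"
        unfolding H(3)[symmetric] using U by (intro sum_mono2) auto
      have wi: "q ^ N * w $ i + h * U i \<le> q ^ N * m + h * (\<Sum>j\<in>{..i}. U j)"
        using that unfolding S_def sum_split by (simp add: algebra_simps)
      have "h * (\<Sum>j\<in>{..<i}. U j) \<le> q ^ N / (q - 1) * (\<Sum>j\<in>{..<i}. U j)"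
        using h U by (intro mult_right_mono sum_nonneg) auto
      then have "q ^ N * w $ i \<le> q ^ N * (m + (\<Sum>j\<in>{..<i}. U j) / (q - 1))"
        using that unfolding S_def by (simp add: algebra_simps)
      then have "w $ i \<le> m + (\<Sum>j\<in>{..<i}. U j) / (q - 1)"
        using qN by simp
      then have "w $ i + U i / (q - 1) \<le> m + (\<Sum>j\<in>{..i}. U j) / (q - 1)"
        unfolding sum_split by (simp add: add_divide_distrib)
      also have "\<dots> \<le> m + H / (q - 1)"
        using sum_le q by (intro add_left_mono divide_right_mono) auto
      finally have xR: "w $ i + U i / (q - 1) < R"
        using mR by simp
      have U_quot: "0 \<le> U i / (q - 1)"
        using U q by simp
      have hU: "h * U i < 1"
      proof -
        have "U i \<le> (\<Sum>j\<in>{..i}. U j)"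
          using U by (intro member_le_sum) auto
        then have "h * U i \<le> h * H"
          using sum_le h by (intro mult_left_mono) auto
        with hH show ?thesis by simp
      qed
      \<comment> \<open>This makes the exact formula available for the valuation of
        \<open>a N i i\<close>.\<close>
      have level: "enat N \<le> max_level p (U i)"
        using p U hU by (intro le_max_level) (auto simp: h_def q_def)
      have "ord (a N i i) = ereal (h * U i - real N)"
        using ord_diag[of N i] level \<open>1 \<le> N\<close> by (simp add: h_def)
      from competitor[OF w(1) this] obtain n j v where
        nj: "(n, j) \<noteq> (N, i)" "ord (a n i j) = ereal v"
          "v + q ^ n * w $ j \<le> h * U i - real N + q ^ N * w $ i"
        by blast
      \<comment> \<open>Beyond R the exponent N need not be optimal. Capping at R still gives a
        lower bound for every power of X_j.\<close>
      define x where "x = min (w $ j) R"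
      have "q ^ N * x - real N \<le> q ^ n * w $ j - real n"
        using q w(2)[of j] \<open>m < R\<close> w(2)[of i0]
        by (intro power_times_minus_min) (auto simp: x_def R_def r_def m_def)
      moreover have "m \<le> x"
        using i0 \<open>m < R\<close> by (simp add: x_def m_def)
      ultimately have x: "q ^ N * x \<le> q ^ n * w $ j - real n + real N" "q ^ N * m \<le> q ^ N * x"
        using qN by auto
      consider "j = i" | "j < i" | "i < j" by fastforce
      then show ?thesis
      proof cases
        case 1
        then have "n \<noteq> N" using nj(1) by simp
        show ?thesis
        proof (cases "max_level p (U i) < enat n")
          case True
          \<comment> \<open>Beyond the maximal level the extra 1 outweighs h \<open>U i\<close> <
            1.\<close>
          then have "1 - real n \<le> v"
            using assms(11) nj(2) 1 by (metis ereal_less_eq(3))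
          moreover have "q ^ N * w $ i - real N < q ^ n * w $ i - real n"
            using q w(2)[of i] xR U_quot \<open>n \<noteq> N\<close>
            by (intro power_times_minus_unique_min) (auto simp: R_def r_def)
          ultimately show ?thesis
            using nj(3) hU 1 by simp
        next
          case False
          have v: "v = (q ^ n - 1) / (q - 1) * U i - real n"
          proof (cases "n = 0")
            case True
            \<comment> \<open>The formula is assumed only for n \<ge> 1; at n = 0 it gives 0, in
              agreement with the valuation of \<open>a 0 i i\<close>.\<close>
            then show ?thesis
              using assms(8) nj(2) 1 by (metis div_0 diff_0_right diff_self ereal_eq_0(2) mult_zero_left of_nat_0 power_0)
          next
            case ne: False
            then show ?thesis
              using ord_diag[of n i] nj(2) 1 False by simp
          qed
          \<comment> \<open>Up to a constant independent of n, the term of \<open>U i\<close> in the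
            valuation shifts \<open>w $ i\<close> by \<open>U i / (q - 1)\<close>. The shifted point
            is still below R, so N remains the unique minimizer.\<close>
          have "q ^ N * (w $ i + U i / (q - 1)) - real N < q ^ n * (w $ i + U i / (q - 1)) - real n"
            using q w(2)[of i] xR U_quot \<open>n \<noteq> N\<close>
            by (intro power_times_minus_unique_min) (simp_all add: R_def[symmetric] r_def[symmetric] del: One_nat_def)
          moreover have "(q ^ k - 1) / (q - 1) * U i = q ^ k * (U i / (q - 1)) - U i / (q - 1)" for k
            by (simp add: diff_divide_distrib algebra_simps)
          ultimately show ?thesis
            using nj(3) unfolding v h_def 1 by (simp add: distrib_left)
        qed
      next
        case 2
        then have "1 - real n \<le> v"
          using assms(13) nj(2) by (metis ereal_less_eq(3))
        then have "q ^ N * m + 1 \<le> q ^ N * w $ i + h * U i"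
          using x nj(3) by simp
        also have "\<dots> \<le> q ^ N * m + h * H"
          using wi mult_left_mono[OF sum_le h(1)] by simp
        finally show ?thesis
          using hH by simp
      next
        case 3
        have "- real n \<le> v"
          using ord_ge[of n i j] nj(2) by simp
        then have "q ^ N * x \<le> q ^ N * w $ i + h * U i"
          using x nj(3) by simp
        also note wi
        finally have xm: "q ^ N * x \<le> q ^ N * m + h * (\<Sum>j\<in>{..i}. U j)" .
        also have "\<dots> \<le> q ^ N * m + q ^ N / (q - 1) * H"
          using h H sum_le U by (intro add_left_mono mult_mono sum_nonneg) auto
        also have "\<dots> = q ^ N * (m + H / (q - 1))"
          by (simp add: algebra_simps)
        also have "\<dots> < q ^ N * R"
          using mR qN by simp
        \<comment> \<open>The cap is therefore inactive, and the bound on x is one on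
          \<open>w $ j\<close> itself.\<close>
        finally have "x < R"
          using qN by simp
        then have "x = w $ j"
          by (auto simp: x_def min_def split: if_splits)
        moreover have "(\<Sum>j\<in>{..i}. U j) \<le> (\<Sum>j\<in>{..<j}. U j)"
          using U 3 by (intro sum_mono2) auto
        then have "h * (\<Sum>j\<in>{..i}. U j) \<le> h * (\<Sum>j\<in>{..<j}. U j)"
          using h by (intro mult_left_mono)
        ultimately have "j \<in> S"
          using xm unfolding S_def by simp
        with 3 show ?thesis by blast
      qed
    qed
    have "i0 \<in> S"
      using h U by (simp add: S_def m_def sum_nonneg)
    \<comment> \<open>Finiteness and nonemptiness give a largest element, which \<open>step\<close>
      contradicts.\<close>
    then have "Max S \<in> S"
      by (intro Max_in) auto
    with step obtain j where "j \<in> S" "Max S < j" by blast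
    then show False
      by (meson Max_ge finite_class.finite_code finite not_less)
  qed

  \<comment> \<open>Emptiness above 1/(p - 1)\<close>
  have not_large: False if w: "w \<in> (\<Inter>i. Trop ord (f i))" "\<And>i. 1 / (q - 1) < w $ i" for w
  proof -
    obtain i where i: "\<And>j. w $ i \<le> w $ j"
      using min_coord by blast
    have "ord (a 0 i i) = ereal 0"
      using assms(8) by (simp add: zero_ereal_def)
    from competitor[OF w(1) this] obtain n j v where
      nj: "(n, j) \<noteq> (0, i)" "ord (a n i j) = ereal v" "v + q ^ n * w $ j \<le> w $ i"
      by auto
    \<comment> \<open>For n = 0 the off-diagonal coefficients vanish, and the diagonal one is the
      monomial being compared against.\<close>
    have n: "0 < n"
      using nj assms(9) by (metis PInfty_neq_ereal(1) gr0I)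
    have "- real n \<le> v"
      using ord_ge[of n i j] nj(2) by simp
    moreover have "q ^ n * w $ i \<le> q ^ n * w $ j"
      using i q by simp
    \<comment> \<open>The bound 1/(q - 1) is the threshold for N = 0, above which the linear term
      wins strictly.\<close>
    moreover have "q ^ 0 * w $ i - real 0 < q ^ n * w $ i - real n"
      using q n w(2)[of i] by (intro power_times_minus_less_above) auto
    ultimately show False
      using nj(3) by simp
  qed

  \<comment> \<open>Conclusion: from the minimal coordinate to all coordinates\<close>
  have "r' \<le> w $ i" if w: "w \<in> (\<Inter>i. Trop ord (f i))" "\<And>i. r < w $ i" for w i
  proof -
    obtain i0 where "\<And>j. w $ i0 \<le> w $ j"
      using min_coord by blast
    with ge[OF w] show ?thesis
      by (meson order_trans)
  qed
  then have "(\<Inter>i. Trop ord (f i)) \<inter> {w. \<forall>i. w $ i > r} = (\<Inter>i. Trop ord (f i)) \<inter> {w. \<forall>i. w $ i \<ge> r'}"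
    using r_less_r' by (fastforce intro: less_le_trans)
  moreover have "(\<Inter>i. Trop ord (f i)) \<inter> {w. \<forall>i. w $ i > 1 / (real p - 1)} = {}"
    using not_large unfolding q_def by blast
  ultimately show ?thesis ..
qed

end
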